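(* Let $A=(a_1,\ldots,a_m)$ be a finite multiset of integers $a_i\ge 2$ such that $c(A)=\sum_{i=1}^{m}(a_i-1)$ is odd. Then there exists some $X_0(A)$ such that $$f(A,n)=\left\lceil\frac{n-1}{c(A)}\right\rceil\quad\text{for all } n\ge X_0(A).$$ Furthermore, taking $X_0(A)$ to be the least positive integer with this property, one has: (i) $X_0((k))\le 2k-1$ for every even $k\ge 2$, where $(k)$ is the multiset with the single element $k$; (ii) $X_0(B_k)\le \binom{2k+1}{2}+1$ for every odd $k\ge 1$, where $B_k=(2,2,\ldots,2)$ ($k$ twos); (iii) $X_0(A)\le c(A)\,\Phi_{2|A|}(2|A|)+1$ for every such $A$, where $\Phi_j$ denotes the $j$th cyclotomic polynomial.
   Context: For a multiset $A=(a_1,\ldots,a_m)$ of integers $a_i\ge 2$, $|A|=m$ is its size counted with multiplicity. The extended conjugacy class $\mathcal{C}(A)\subset S_n$ of $A$ is the set of all permutations in $S_n$ whose decomposition into disjoint nontrivial cycles consists of cycles of lengths $a_1,\ldots,a_m$ (with multiplicity) and no others; fixed points are allowed. $f(A,n)$ is the infimum of $|G|$ over all subsets $G\subset\mathcal{C}(A)$ that generate the symmetric group $S_n$ (with $f(A,n)=\infty$ if there is no such $G$). *)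

theory Defs
  imports
    "HOL-Algebra.Sym_Groups"
    "HOL-Library.Multiset"
    "HOL-Library.Extended_Nat"
    "HOL-Library.Complex_Order"
    "HOL-Computational_Algebra.Polynomial"
begin

definition cval :: "nat multiset \<Rightarrow> nat" where
  "cval A = (\<Sum>a\<in>#A. a - 1)"

text \<open>
  Permutations in \<open>S\<^sub>n\<close> act on \<open>{1..n}\<close> and are the identity elsewhere, as in \<^const>\<open>sym_group\<close>.
  Disjointness of the cycles, and the absence of repetitions within each of them, are both
  expressed by \<open>distinct (concat css)\<close>.
\<close>

definition ext_conj_class :: "nat multiset \<Rightarrow> nat \<Rightarrow> (nat \<Rightarrow> nat) set" where
  "ext_conj_class A n =
     {p \<in> carrier (sym_group n).
        \<exists>css. distinct (concat css) \<and> (\<forall>cs\<in>set css. length cs \<ge> 2) \<and>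
              p = foldr (\<circ>) (map cycle_of_list css) id \<and>
              mset (map length css) = A}"

text \<open>
  All sets \<open>G\<close> below are finite, so \<^const>\<open>card\<close> is their true size; the infimum over the
  empty family is \<open>\<infinity>\<close> in \<^typ>\<open>enat\<close>.
\<close>

definition f_gen :: "nat multiset \<Rightarrow> nat \<Rightarrow> enat" where
  "f_gen A n =
     (INF G \<in> {G. G \<subseteq> ext_conj_class A n \<and>
                  generate (sym_group n) G = carrier (sym_group n)}. enat (card G))"

definition X0 :: "nat multiset \<Rightarrow> nat" where
  "X0 A = (LEAST X. 0 < X \<and>
     (\<forall>n\<ge>X. f_gen A n = enat (nat \<lceil>(real n - 1) / real (cval A)\<rceil>)))"

definition primitive_roots_of_unity :: "nat \<Rightarrow> complex set" where
  "primitive_roots_of_unity j = {z. z ^ j = 1 \<and> (\<forall>i. 0 < i \<and> i < j \<longrightarrow> z ^ i \<noteq> 1)}"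

text \<open>
  The values at integers are real. Inequalities between them are read in the order on
  \<^typ>\<open>complex\<close>, where \<open>x \<le> y\<close> means \<open>Re x \<le> Re y\<close> and \<open>Im x = Im y\<close>.
\<close>

definition cyclotomic :: "nat \<Rightarrow> complex poly" where
  "cyclotomic j = (\<Prod>\<zeta>\<in>primitive_roots_of_unity j. [:- \<zeta>, 1:])"

end

(*
  A generating set of S_n makes n points connected, and a permutation of type A contributes a
  forest with c(A) edges, so at least (n - 1) / c(A) generators are needed.

  Conversely, if S_n is generated by t permutations of type A and n is not too small, one more
  permutation of type A, each of whose cycles has a point in {1..n}, reaches up to c(A) new points.
  It therefore suffices to find T generators on exactly T c(A) + 1 points for one small T.
  For T = 4 their 4 |A| cycles are laid out as a path of intervals, consecutive ones sharing one
  point, in the order 0 1 (2 0)...(2 0) 2 (3 1)...(3 1) 3 of the generators to which they belong.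
  Generators 0 and 1 have one common moved point, so that their commutator is a 3-cycle; the
  relation of lying on a common 3-cycle is then forced to be total, which gives the alternating
  group, and the generators are odd. If |A| = 1, the word 0 1 does the same with T = 2.
  Hence X_0(A) <= 4 c(A) + 1, and X_0(A) <= 2 c(A) + 1 for |A| = 1, which is below all the
  stated bounds because Phi_2(2) = 3 and Phi_{2m}(2m) >= (2m - 1)^2 for m > 1.
*)
theory Submission
  imports Defs
begin

section \<open>Subgroups of the symmetric group\<close>


lemma subgroup_sym_group_comp:
  assumes "subgroup H (sym_group n)" "p \<in> H" "q \<in> H"
  shows "p \<circ> q \<in> H"
  using subgroup.m_closed[OF assms] by (simp add: sym_group_mult)

lemma subgroup_sym_group_permutes:
  assumes "subgroup H (sym_group n)" "p \<in> H"
  shows "p permutes {1..n}"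
  using subgroup.mem_carrier[OF assms] by (simp add: sym_group_carrier)

lemma subgroup_sym_group_inv:
  assumes "subgroup H (sym_group n)" "p \<in> H"
  shows "inv' p \<in> H"
  using subgroup.m_inv_closed[OF assms] sym_group_inv_equality[OF subgroup.mem_carrier[OF assms]]
  by simp

lemma subgroup_generate_sym_group:
  assumes "G \<subseteq> carrier (sym_group n)"
  shows "subgroup (generate (sym_group n) G) (sym_group n)"
  using group.generate_is_subgroup[OF sym_group_is_group assms] .

lemma subgroup_sym_group_conj_cycle:
  assumes H: "subgroup H (sym_group n)" and p: "p \<in> H" and c: "cycle_of_list cs \<in> H" "distinct cs"
  shows "cycle_of_list (map p cs) \<in> H"
proof -
  have "bij p" using subgroup_sym_group_permutes[OF H p] permutes_bij by blast
  then show ?thesis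
    using conjugation_of_cycle[OF c(2), of p] subgroup_sym_group_comp[OF H]
      subgroup_sym_group_inv[OF H p] p c(1) by metis
qed

text \<open>Strong induction on \<open>j\<close>. Connectedness of the generators is always used in
  this ascending form: every point beyond the initial ones is the image of a smaller point, as the
  explicit cycles make evident.\<close>

lemma subset_closed_under_ascending:
  fixes B :: "nat set"
  assumes "1 \<in> B" and closed: "\<And>g i. g \<in> G \<Longrightarrow> i \<in> B \<Longrightarrow> g i \<in> B"
    and asc: "\<And>j. j \<in> {2..n} \<Longrightarrow> \<exists>g\<in>G. \<exists>i\<in>{1..<j}. g i = j"
  shows "{1..n} \<subseteq> B"
proof
  fix j assume "j \<in> {1..n}"
  then show "j \<in> B"
  proof (induction j rule: less_induct)
    case (less j)
    show ?case
    proof (cases "j = 1")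
      case False
      then obtain g i where "g \<in> G" "i \<in> {1..<j}" "g i = j"
        using asc[of j] less.prems by auto
      then show ?thesis using closed[of g i] less.IH[of i] less.prems by auto
    qed (use assms(1) in simp)
  qed
qed

section \<open>Transpositions in a subgroup and raising the degree\<close>

lemma transpose_conj:
  assumes "bij p"
  shows "p \<circ> transpose a b \<circ> inv' p = transpose (p a) (p b)"
  using assms by (auto simp: fun_eq_iff transpose_def bij_is_inj bij_is_surj surj_f_inv_f)

lemma subgroup_sym_group_conj_transpose:
  assumes H: "subgroup H (sym_group n)" and p: "p \<in> H" and c: "transpose a b \<in> H"
  shows "transpose (p a) (p b) \<in> H"
proof -
  have "bij p" using subgroup_sym_group_permutes[OF H p] permutes_bij by blast
  then show ?thesis
    using transpose_conj[of p a b] subgroup_sym_group_comp[OF H]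
      subgroup_sym_group_inv[OF H p] p c(1) by metis
qed

text \<open>Conjugation of (a b) by (b c) gives (a c). Hence the points whose transposition with a
  given point lies in \<open>H\<close> form a block.\<close>

lemma transpose_mem_trans:
  assumes H: "subgroup H (sym_group n)" and "transpose a b \<in> H" "transpose b c \<in> H"
  shows "transpose a c \<in> H"
proof (cases "a = c \<or> b = c \<or> a = b")
  case True
  have "id \<in> H" using subgroup.one_closed[OF H] by (simp add: sym_group_one)
  with True assms show ?thesis by auto
next
  case False
  have "transpose (transpose b c a) (transpose b c b) \<in> H"
    by (rule subgroup_sym_group_conj_transpose[OF H assms(3,2)])
  with False show ?thesis by (simp add: transpose_def)
qed

lemma subgroup_eq_sym_group_if_transposes:
  assumes H: "subgroup H (sym_group n)" and t: "\<And>i. i \<in> {1..n} \<Longrightarrow> transpose 1 i \<in> H"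
  shows "H = carrier (sym_group n)"
proof
  show "H \<subseteq> carrier (sym_group n)" by (rule subgroup.subset[OF H])
  show "carrier (sym_group n) \<subseteq> H"
  proof
    fix p assume "p \<in> carrier (sym_group n)"
    then have "p permutes {1..n}" by (simp add: sym_group_carrier)
    then show "p \<in> H"
      using finite_atLeastAtMost
    proof (induction rule: permutes_induct)
      case id
      show ?case using subgroup.one_closed[OF H] unfolding sym_group_one .
    next
      case (swap a b p)
      have "transpose a 1 \<in> H" using t[OF swap(1)] by (simp add: transpose_commute)
      then have "transpose a b \<in> H" using transpose_mem_trans[OF H] t[OF swap(2)] by blast
      then show ?case using subgroup_sym_group_comp[OF H] swap by blast
    qed
  qed
qed

text \<open>The block of \<open>1\<close> under transpositions contains the old points, and it is
  closed under \<open>s\<close>: if \<open>i\<close> is in it, so is (z i), and conjugation by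
  \<open>s\<close> turns this into the transposition of \<open>z\<close> and \<open>s i\<close>,
  because \<open>s\<close> fixes \<open>z\<close>. The ascending condition then brings in every new
  point.\<close>

lemma generate_sym_group_extend:
  assumes G: "generate (sym_group n) G = carrier (sym_group n)" "G \<subseteq> carrier (sym_group n)"
    and le: "n \<le> N" and s: "s \<in> carrier (sym_group N)"
    and fixed: "z \<in> {1..n}" "s z = z"
    and asc: "\<And>j. j \<in> {n<..N} \<Longrightarrow> \<exists>i\<in>{1..<j}. s i = j"
  shows "generate (sym_group N) (insert s G) = carrier (sym_group N)"
proof -
  let ?H = "generate (sym_group N) (insert s G)"
  have sub: "carrier (sym_group n) \<subseteq> carrier (sym_group N)"
    using permutes_subset[where T = "{1..N}"] le by (fastforce simp: sym_group_carrier)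
  have H: "subgroup ?H (sym_group N)"
    using G(2) s sub by (intro subgroup_generate_sym_group) auto
  \<comment> \<open>Generation is relative to the ambient group, so it is transferred from degree
    \<open>n\<close> to degree \<open>N\<close> by induction; the inverse is \<open>inv'\<close> in
    both.\<close>
  have "p \<in> ?H" if "p \<in> generate (sym_group n) G" for p
    using that
  proof induction
    case one
    show ?case using generate.one[of "sym_group N"] unfolding sym_group_one .
  next
    case (incl h)
    then show ?case by (simp add: generate.incl)
  next
    case (inv h)
    then have "inv\<^bsub>sym_group n\<^esub> h = inv' h" using G(2) by auto
    then show ?case
      using inv subgroup_sym_group_inv[OF H generate.incl[of h]] by simp
  next
    case (eng h1 h2)
    then show ?case using subgroup_sym_group_comp[OF H] unfolding sym_group_mult by blast
  qed
  then have SnH: "carrier (sym_group n) \<subseteq> ?H" using G(1) by auto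
  have tr: "transpose a b \<in> ?H" if "a \<in> {1..n}" "b \<in> {1..n}" for a b
    using SnH permutes_swap_id[OF that] by (auto simp: sym_group_carrier)
  have sH: "s \<in> ?H" by (simp add: generate.incl)
  define C where "C = {i. transpose 1 i \<in> ?H}"
  have sub: "{1..n} \<subseteq> C" using tr fixed(1) by (auto simp: C_def)
  have sC: "s i \<in> C" if "i \<in> C" for i
  proof -
    have z1: "transpose 1 z \<in> ?H" using sub fixed(1) by (auto simp: C_def)
    have "transpose z i \<in> ?H"
      using transpose_mem_trans[OF H, of z 1 i] z1 that by (simp add: C_def transpose_commute)
    then have "transpose (s z) (s i) \<in> ?H"
      by (rule subgroup_sym_group_conj_transpose[OF H sH])
    then show ?thesis using transpose_mem_trans[OF H z1] fixed(2) by (simp add: C_def)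
  qed
  have "j \<in> C" if "j \<in> {1..N}" for j
    using that
  proof (induction j rule: less_induct)
    case (less j)
    show ?case
    proof (cases "j \<le> n")
      case False
      then obtain i where "i \<in> {1..<j}" "s i = j" using asc[of j] less.prems by auto
      then show ?thesis using sC[of i] less.IH[of i] less.prems by auto
    qed (use sub less.prems in auto)
  qed
  then show ?thesis by (intro subgroup_eq_sym_group_if_transposes[OF H]) (simp add: C_def)
qed

text \<open>The left side is the commutator, since the inverse of \<open>t \<circ> s\<close> is the
  inverse of \<open>s\<close> after that of \<open>t\<close>. A single common moved point forces
  \<open>t\<close> to fix \<open>s x\<close> and \<open>s\<close> to fix \<open>t x\<close>; all
  other points are compared according to which of \<open>s\<close> and \<open>t\<close> moves
  them.\<close>

lemma commutator_single_common_point: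
  assumes "bij s" "bij t" and x: "s x \<noteq> x" "t x \<noteq> x"
    and single: "\<And>i. s i \<noteq> i \<Longrightarrow> t i \<noteq> i \<Longrightarrow> i = x"
  shows "s \<circ> t \<circ> inv' (t \<circ> s) = cycle_of_list [x, s x, t x]"
proof -
  have inj: "s a = s b \<longleftrightarrow> a = b" "t a = t b \<longleftrightarrow> a = b" for a b
    using assms(1,2) by (auto simp: bij_def inj_eq)
  have tsx: "t (s x) = s x" and stx: "s (t x) = t x"
    using single[of "s x"] single[of "t x"] inj(1)[of "s x" x] inj(2)[of "t x" x] x by auto
  have ne: "s x \<noteq> t x" using tsx inj(2)[of "t x" x] x by auto
  have "s (t i) = cycle_of_list [x, s x, t x] (t (s i))" for i
  proof (cases "i = x")
    case True
    then show ?thesis using tsx stx ne x by (simp add: transpose_def)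
  next
    case False
    then consider "t i = i" "s i = i" | "t i = i" "s i \<noteq> i" | "t i \<noteq> i" "s i = i" using single by blast
    then show ?thesis
    proof cases
      case 1
      with x inj False show ?thesis by (auto simp: transpose_def)
    next
      case 2
      then have "s (s i) \<noteq> s i" using inj by simp
      then have "t (s i) = s i \<or> s i = x" using single by blast
      then show ?thesis using 2 False inj x ne by (auto simp: transpose_def)
    next
      case 3
      then have "t (t i) \<noteq> t i" using inj by simp
      then have "s (t i) = t i \<or> t i = x" using single by blast
      then show ?thesis using 3 False inj x ne by (auto simp: transpose_def)
    qed
  qed
  then have "s \<circ> t = cycle_of_list [x, s x, t x] \<circ> (t \<circ> s)" by (simp add: fun_eq_iff)
  moreover have "(t \<circ> s) \<circ> inv' (t \<circ> s) = id"
    using bij_is_surj[OF bij_comp[OF assms(1,2)]] unfolding surj_iff .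
  ultimately show ?thesis by (simp add: comp_assoc)
qed

section \<open>Three-cycles in a subgroup and the alternating group\<close>

lemma cycle_of_list_3_rotate:
  assumes "distinct [a, b, c]"
  shows "cycle_of_list [b, c, a] = cycle_of_list [a, b, c]"
  using assms by (auto simp: fun_eq_iff transpose_def)

lemma cycle_of_list_3_inv:
  assumes "distinct [a, b, c]"
  shows "inv' (cycle_of_list [a, b, c]) = cycle_of_list [c, b, a]"
  using assms by (intro inv_unique_comp) (auto simp: fun_eq_iff transpose_def)

context
  fixes H :: "(nat \<Rightarrow> nat) set" and n :: nat
  assumes H: "subgroup H (sym_group n)"
begin

text \<open>The disjunct \<open>x = y\<close> supplies reflexivity, so this is an equivalence
  relation. The orientation of the cycle is immaterial because \<open>H\<close> contains
  inverses.\<close>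

definition three_related :: "nat \<Rightarrow> nat \<Rightarrow> bool" where
  "three_related x y \<longleftrightarrow> x = y \<or> (\<exists>z. distinct [x, y, z] \<and> cycle_of_list [x, y, z] \<in> H)"

lemma three_cycle_rotate:
  assumes "distinct [a, b, c]" "cycle_of_list [a, b, c] \<in> H"
  shows "cycle_of_list [b, c, a] \<in> H"
  using assms cycle_of_list_3_rotate by metis

lemma three_cycle_inv:
  assumes "distinct [a, b, c]" "cycle_of_list [a, b, c] \<in> H"
  shows "cycle_of_list [c, b, a] \<in> H"
  using assms cycle_of_list_3_inv subgroup_sym_group_inv[OF H] by metis

lemma three_cycle_conj:
  assumes "cycle_of_list [a, b, c] \<in> H" "p \<in> H" "distinct [a, b, c]"
  shows "cycle_of_list [p a, p b, p c] \<in> H" "distinct [p a, p b, p c]"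
proof -
  show "cycle_of_list [p a, p b, p c] \<in> H"
    using subgroup_sym_group_conj_cycle[OF H assms(2,1,3)] by simp
  have "inj p" using subgroup_sym_group_permutes[OF H assms(2)] permutes_inj by blast
  then show "distinct [p a, p b, p c]" using assms(3) by (auto simp: inj_eq)
qed

lemma three_related_conj:
  assumes "three_related x y" "p \<in> H"
  shows "three_related (p x) (p y)"
  using assms three_cycle_conj[of x y _ p] unfolding three_related_def by blast

lemma three_related_sym: "three_related x y \<Longrightarrow> three_related y x"
proof (cases "x = y")
  case False
  assume "three_related x y"
  then obtain z where z: "distinct [x, y, z]" "cycle_of_list [x, y, z] \<in> H"
    using False unfolding three_related_def by blast
  have "cycle_of_list [y, x, z] \<in> H"
    using three_cycle_rotate[OF _ three_cycle_inv[OF z]] z(1) by auto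
  moreover have "distinct [y, x, z]" using z(1) by auto
  ultimately show ?thesis unfolding three_related_def by blast
qed (simp add: three_related_def)

text \<open>Given (x y z) and (y w v): if \<open>v = x\<close>, the second cycle already joins
  \<open>x\<close> and \<open>w\<close>. Otherwise it fixes \<open>x\<close> and sends
  \<open>y\<close> to \<open>w\<close>, so conjugation by it turns the first cycle into one through
  \<open>x\<close> and \<open>w\<close>.\<close>

lemma three_related_trans:
  assumes "three_related x y" "three_related y w"
  shows "three_related x w"
proof (cases "x = y \<or> y = w \<or> x = w")
  case False
  with assms obtain z v where z: "distinct [x, y, z]" "cycle_of_list [x, y, z] \<in> H"
    and v: "distinct [y, w, v]" "cycle_of_list [y, w, v] \<in> H"
    unfolding three_related_def by blast
  show ?thesis
  proof (cases "v = x")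
    case True
    then have "three_related w x"
      unfolding three_related_def using three_cycle_rotate[OF v] v(1) by (intro disjI2 exI[of _ y]) auto
    then show ?thesis by (rule three_related_sym)
  next
    case v_ne: False
    let ?p = "cycle_of_list [y, w, v]"
    have "?p x = x" using False v_ne by (intro id_outside_supp) auto
    moreover have "?p y = w" using v(1) by (auto simp: transpose_def)
    ultimately show ?thesis
      unfolding three_related_def using three_cycle_conj[OF z(2) v(2) z(1)] by auto
  qed
qed (use assms three_related_def in auto)

text \<open>Relatedness gives some (x y z), and \<open>z\<close> must be exchanged for
  \<open>w\<close> by means of a cycle (z w v). If \<open>v\<close> avoids \<open>x\<close> and
  \<open>y\<close>, conjugation by it does so. If \<open>v = x\<close>, conjugating (z w v) by (x y
  z) gives the inverse of the desired cycle, and if \<open>v = y\<close>, conjugating it twice gives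
  the cycle itself.\<close>

lemma three_cycle_mem_if_all_related:
  assumes rel: "\<And>i j. i \<in> S \<Longrightarrow> j \<in> S \<Longrightarrow> three_related i j"
    and S: "{x, y, w} \<subseteq> S" and d: "distinct [x, y, w]"
  shows "cycle_of_list [x, y, w] \<in> H"
proof -
  obtain z where z: "distinct [x, y, z]" "cycle_of_list [x, y, z] \<in> H"
    using rel[of x y] S d by (auto simp: three_related_def)
  show ?thesis
  proof (cases "z = w")
    case False
    \<comment> \<open>The point \<open>z\<close> is not known to lie in \<open>S\<close>, so its
      relation to \<open>w\<close> is obtained through \<open>y\<close>.\<close>
    have zw: "three_related z w"
    proof -
      have "three_related y z"
        unfolding three_related_def using three_cycle_rotate[OF z] z(1)
        by (intro disjI2 exI[of _ x]) auto
      then show ?thesis using three_related_trans[of z y w] three_related_sym rel[of y w] S by auto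
    qed
    then obtain v where v: "distinct [z, w, v]" "cycle_of_list [z, w, v] \<in> H"
      using False by (auto simp: three_related_def)
    let ?p = "cycle_of_list [z, w, v]" and ?q = "cycle_of_list [x, y, z]"
    have pz: "?p z = w" using v(1) by (auto simp: transpose_def)
    have q: "?q x = y" "?q y = z" "?q z = x" "?q w = w"
      using z(1) d False by (auto simp: transpose_def)
    consider "v \<noteq> x" "v \<noteq> y" | "v = x" | "v = y" by blast
    then show ?thesis
    proof cases
      case 1
      then have "?p x = x" "?p y = y" using d z(1) by (intro id_outside_supp; auto)+
      then show ?thesis using three_cycle_conj(1)[OF z(2) v(2) z(1)] pz by simp
    next
      case 2
      have "cycle_of_list [x, w, y] \<in> H"
        using three_cycle_conj(1)[OF v(2) z(2) v(1)] q 2 by simp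
      moreover have "distinct [x, w, y]" using d by auto
      ultimately have "cycle_of_list [y, w, x] \<in> H" using three_cycle_inv by blast
      then have "cycle_of_list [w, x, y] \<in> H" using three_cycle_rotate[of y w x] d by auto
      then show ?thesis using three_cycle_rotate[of w x y] d by auto
    next
      case 3
      have "distinct [x, w, z]" "cycle_of_list [x, w, z] \<in> H"
        using three_cycle_conj[OF v(2) z(2) v(1)] unfolding 3 q by simp_all
      from three_cycle_conj(1)[OF this(2) z(2) this(1)] have "cycle_of_list [y, w, x] \<in> H"
        unfolding q .
      then have "cycle_of_list [w, x, y] \<in> H" using three_cycle_rotate[of y w x] d by auto
      then show ?thesis using three_cycle_rotate[of w x y] d by auto
    qed
  qed (use z in simp)
qed

lemma alt_group_subset_if_three_cycles:
  assumes "three_cycles n \<subseteq> H"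
  shows "carrier (alt_group n) \<subseteq> H"
proof
  fix p assume "p \<in> carrier (alt_group n)"
  then have "p \<in> generate (alt_group n) (three_cycles n)"
    using alt_group_carrier_as_three_cycles by simp
  then show "p \<in> H"
  proof induction
    case one
    show ?case using subgroup.one_closed[OF H] unfolding alt_group_one sym_group_one .
  next
    case (incl h)
    then show ?case using assms by auto
  next
    case (inv h)
    then have "inv\<^bsub>alt_group n\<^esub> h = inv' h"
      using alt_group_inv_equality[of h n] three_cycles_incl[of n] by blast
    then show ?case using inv assms subgroup_sym_group_inv[OF H] by auto
  next
    case (eng h1 h2)
    then show ?case using subgroup_sym_group_comp[OF H] unfolding alt_group_mult by blast
  qed
qed

lemma subgroup_eq_sym_group_if_alt_subset:
  assumes alt: "carrier (alt_group n) \<subseteq> H" and g: "g \<in> H" "\<not> evenperm g"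
  shows "H = carrier (sym_group n)"
proof
  show "H \<subseteq> carrier (sym_group n)" by (rule subgroup.subset[OF H])
  show "carrier (sym_group n) \<subseteq> H"
  proof
    fix p assume "p \<in> carrier (sym_group n)"
    then have p: "p permutes {1..n}" by (simp add: sym_group_carrier)
    have gp: "g permutes {1..n}" by (rule subgroup_sym_group_permutes[OF H g(1)])
    have perm: "permutation g" "permutation p"
      using p gp permutation_permutes by blast+
    show "p \<in> H"
    proof (cases "evenperm p")
      case True
      then show ?thesis using alt p by (auto simp: alt_group_carrier)
    next
      case False
      have "evenperm (g \<circ> p)" using False g(2) perm by (simp add: evenperm_comp)
      then have "g \<circ> p \<in> H"
        using alt permutes_compose[OF p gp] by (auto simp: alt_group_carrier)
      then have "inv' g \<circ> (g \<circ> p) \<in> H"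
        using subgroup_sym_group_comp[OF H] subgroup_sym_group_inv[OF H g(1)] by blast
      moreover have "inv' g \<circ> (g \<circ> p) = p"
        using permutes_inv_o(2)[OF gp] by (simp add: o_assoc)
      ultimately show ?thesis by simp
    qed
  qed
qed

end

text \<open>
  The blocks of points joined by 3-cycles are permuted by the group. The commutator of \<open>s\<close> and
  \<open>t\<close> is the 3-cycle on \<open>x\<close>, \<open>s x = 1\<close> and \<open>t x\<close>, so the block of \<open>1\<close> is fixed by \<open>s\<close> and \<open>t\<close>;
  the other generators fix it because they fix \<open>1\<close>.
\<close>
lemma generate_sym_group_if_single_common_point:
  assumes G: "G \<subseteq> carrier (sym_group n)" and odd: "\<And>g. g \<in> G \<Longrightarrow> \<not> evenperm g"
    and st: "s \<in> G" "t \<in> G" and x: "s x \<noteq> x" "t x \<noteq> x" "s x = 1"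
    and single: "\<And>i. s i \<noteq> i \<Longrightarrow> t i \<noteq> i \<Longrightarrow> i = x"
    and fix1: "\<And>g. g \<in> G \<Longrightarrow> g \<noteq> s \<Longrightarrow> g 1 = 1"
    and asc: "\<And>j. j \<in> {2..n} \<Longrightarrow> \<exists>g\<in>G. \<exists>i\<in>{1..<j}. g i = j"
  shows "generate (sym_group n) G = carrier (sym_group n)"
proof -
  let ?H = "generate (sym_group n) G"
  have H: "subgroup ?H (sym_group n)" by (rule subgroup_generate_sym_group[OF G])
  have GH: "G \<subseteq> ?H" by (auto intro: generate.incl)
  have perm: "g permutes {1..n}" if "g \<in> G" for g using that G by (auto simp: sym_group_carrier)
  have stH: "s \<in> ?H" "t \<in> ?H" using st GH by auto
  have bij: "bij s" "bij t" using perm st permutes_bij by blast+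
  have "s \<circ> t \<circ> inv' (t \<circ> s) \<in> ?H"
    using subgroup_sym_group_comp[OF H] subgroup_sym_group_inv[OF H] stH by blast
  then have c: "cycle_of_list [x, s x, t x] \<in> ?H"
    using commutator_single_common_point[OF bij x(1,2) single] by simp
  \<comment> \<open>If \<open>s x\<close> and \<open>t x\<close> coincided, this point would be
    moved by both \<open>s\<close> and \<open>t\<close> and hence be \<open>x\<close>.\<close>
  have ne: "s x \<noteq> t x" using single[of "s x"] x(1,2) bij by (metis bij_pointE)
  have d: "distinct [x, s x, t x]" using x ne by auto
  have "three_related ?H x 1"
    unfolding three_related_def[OF H] using c d x(3) by auto
  then have x1: "three_related ?H 1 x" by (rule three_related_sym[OF H])
  define B where "B = {i. three_related ?H 1 i}"
  have closed: "g i \<in> B" if "g \<in> G" "i \<in> B" for g i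
  proof -
    have "three_related ?H (g 1) (g i)"
      using three_related_conj[OF H, of 1 i g] that GH by (auto simp: B_def)
    moreover have "three_related ?H 1 (g 1)"
    proof (cases "g = s")
      case True
      \<comment> \<open>The relation between \<open>x\<close> and \<open>1\<close> is moved by
        \<open>s\<close>; since \<open>s x = 1\<close>, it becomes one between \<open>1\<close> and
        \<open>s 1\<close>.\<close>
      have "three_related ?H (s x) (s 1)" using three_related_conj[OF H _ stH(1)] x1
          three_related_sym[OF H] by blast
      then show ?thesis using True x(3) by simp
    next
      case False
      then have "g 1 = 1" using fix1 that by blast
      then show ?thesis unfolding three_related_def[OF H] by (intro disjI1) simp
    qed
    ultimately show ?thesis using three_related_trans[OF H, of 1 "g 1" "g i"] by (simp add: B_def)
  qed
  have "1 \<in> B" unfolding B_def three_related_def[OF H] by simp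
  then have "{1..n} \<subseteq> B" using subset_closed_under_ascending[where B = B and G = G and n = n] closed asc by blast
  then have rel: "three_related ?H i j" if "i \<in> {1..n}" "j \<in> {1..n}" for i j
    using that three_related_trans[OF H] three_related_sym[OF H] unfolding B_def by blast
  have "three_cycles n \<subseteq> ?H"
  proof
    fix p assume "p \<in> three_cycles n"
    then obtain cs where cs: "p = cycle_of_list cs" "distinct cs" "length cs = 3" "set cs \<subseteq> {1..n}"
      by auto
    obtain a b c where "cs = [a, b, c]" using stupid_lemma[OF cs(3)] by blast
    then show "p \<in> ?H" using three_cycle_mem_if_all_related[OF H, of "{1..n}" a b c] rel cs by auto
  qed
  then show ?thesis
    using subgroup_eq_sym_group_if_alt_subset[OF H alt_group_subset_if_three_cycles[OF H]]
      stH(1) odd[OF st(1)] by blast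
qed

section \<open>Products of disjoint cycles\<close>


definition cycle_product :: "nat list list \<Rightarrow> nat \<Rightarrow> nat" where
  "cycle_product css = foldr (\<circ>) (map cycle_of_list css) id"

lemma cycle_product_simps [simp]:
  "cycle_product [] = id"
  "cycle_product (cs # css) = cycle_of_list cs \<circ> cycle_product css"
  by (simp_all add: cycle_product_def)

lemma cycle_product_outside: "x \<notin> set (concat css) \<Longrightarrow> cycle_product css x = x"
  by (induction css) (auto simp: id_outside_supp)

lemma cycle_product_apply:
  assumes "distinct (concat css)" "cs \<in> set css" "x \<in> set cs"
  shows "cycle_product css x = cycle_of_list cs x"
  using assms
proof (induction css)
  case (Cons c css)
  show ?case
  proof (cases "cs = c")
    case True
    then have "x \<notin> set (concat css)" using Cons.prems by auto
    then show ?thesis using True cycle_product_outside by simp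
  next
    case False
    then have cs: "cs \<in> set css" using Cons.prems by simp
    then have "cycle_product css x = cycle_of_list cs x" using Cons by simp
    moreover have "cycle_of_list cs x \<in> set cs"
      using permutes_in_image[OF cycle_permutes[of cs]] Cons.prems(3) by simp
    then have "cycle_of_list cs x \<notin> set c" using Cons.prems(1) cs by auto
    ultimately show ?thesis by (simp add: id_outside_supp)
  qed
qed simp

lemma cycle_product_permutes: "cycle_product css permutes set (concat css)"
proof (induction css)
  case Nil
  then show ?case by (simp add: permutes_id[unfolded id_def] id_def)
next
  case (Cons cs css)
  have "cycle_of_list cs permutes set (concat (cs # css))"
    using permutes_subset[OF cycle_permutes[of cs]] by simp
  moreover have "cycle_product css permutes set (concat (cs # css))"
    using permutes_subset[OF Cons] by simp
  ultimately show ?case unfolding cycle_product_simps by (intro permutes_compose)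
qed

text \<open>A cycle of length l is a product of l - 1 transpositions. For type \<open>A\<close>
  these numbers add up to \<open>cval A\<close>, so odd \<open>cval A\<close> means odd
  generators.\<close>

lemma evenperm_cycle_product:
  assumes "distinct (concat css)"
  shows "evenperm (cycle_product css) \<longleftrightarrow> even (\<Sum>cs\<leftarrow>css. length cs - 1)"
  using assms
proof (induction css)
  case (Cons cs css)
  have "swapidseq (length cs - 1) (cycle_of_list cs)"
    using swapidseq_ext_imp_swapidseq[OF swapidseq_ext_of_cycles] Cons.prems by auto
  then have "evenperm (cycle_of_list cs) \<longleftrightarrow> even (length cs - 1)" using evenperm_unique by blast
  moreover have "permutation (cycle_product css)"
    using cycle_product_permutes permutation_permutes by blast
  ultimately show ?case
    unfolding cycle_product_simps using Cons by (subst evenperm_comp) (auto simp: permutation_of_cycle)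
qed (simp add: evenperm_id)

lemma cycle_product_in_ext_conj_class:
  assumes "distinct (concat css)" "\<forall>cs\<in>set css. 2 \<le> length cs" "set (concat css) \<subseteq> {1..n}"
    "mset (map length css) = A"
  shows "cycle_product css \<in> ext_conj_class A n"
  using assms permutes_subset[OF cycle_product_permutes assms(3)]
  unfolding ext_conj_class_def cycle_product_def sym_group_carrier by blast

lemma ext_conj_class_subset_carrier: "ext_conj_class A n \<subseteq> carrier (sym_group n)"
  by (auto simp: ext_conj_class_def)

lemma ext_conj_class_mono:
  assumes "n \<le> N"
  shows "ext_conj_class A n \<subseteq> ext_conj_class A N"
proof -
  have "{1..n} \<subseteq> {1..N}" using assms by auto
  then show ?thesis
    unfolding ext_conj_class_def sym_group_carrier using permutes_subset by blast
qed

lemma cval_mset: "cval (mset as) = (\<Sum>a\<leftarrow>as. a - 1)"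
  unfolding cval_def by (metis mset_map sum_mset_sum_list)

lemma size_le_cval:
  assumes "\<forall>a\<in>#A. 2 \<le> a"
  shows "size A \<le> cval A"
  using assms unfolding cval_def by (induction A) auto

lemma cycle_of_list_nth_Suc:
  assumes "distinct cs" "Suc k < length cs"
  shows "cycle_of_list cs (cs ! k) = cs ! Suc k"
proof -
  have "map (cycle_of_list cs) cs ! k = rotate1 cs ! k"
    using cyclic_rotation[OF assms(1), of 1] by simp
  then show ?thesis using assms(2) by (simp add: nth_rotate1)
qed

lemma cycle_of_list_last:
  assumes "distinct cs" "cs \<noteq> []"
  shows "cycle_of_list cs (last cs) = hd cs"
proof -
  have "map (cycle_of_list cs) cs ! (length cs - 1) = rotate1 cs ! (length cs - 1)"
    using cyclic_rotation[OF assms(1), of 1] by simp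
  then show ?thesis using assms(2) by (simp add: nth_rotate1 last_conv_nth hd_conv_nth)
qed

lemma cycle_of_list_upt_Suc:
  assumes "u \<le> i" "Suc i < v"
  shows "cycle_of_list [u..<v] i = Suc i"
  using cycle_of_list_nth_Suc[of "[u..<v]" "i - u"] assms by simp

section \<open>Comb-shaped permutations and adding one generator\<close>

text \<open>Used with heads among the old points and tails that cover the new ones.\<close>
fun comb_cycles :: "nat \<Rightarrow> nat \<Rightarrow> nat list \<Rightarrow> nat list list" where
  "comb_cycles h s [] = []"
| "comb_cycles h s (a # as) = (h # [s..<s + (a - 1)]) # comb_cycles (Suc h) (s + (a - 1)) as"

lemma length_comb_cycles:
  "\<forall>a\<in>set as. 2 \<le> a \<Longrightarrow> map length (comb_cycles h s as) = as"
  by (induction h s as rule: comb_cycles.induct) auto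

lemma set_comb_cycles:
  "set (concat (comb_cycles h s as)) = {h..<h + length as} \<union> {s..<s + (\<Sum>a\<leftarrow>as. a - 1)}"
  by (induction h s as rule: comb_cycles.induct) auto

lemma distinct_comb_cycles:
  "h + length as \<le> s \<Longrightarrow> distinct (concat (comb_cycles h s as))"
proof (induction h s as rule: comb_cycles.induct)
  case (2 h s a as)
  have "distinct (concat (comb_cycles (Suc h) (s + (a - 1)) as))" using 2 by simp
  moreover have "set (h # [s..<s + (a - 1)]) \<inter> set (concat (comb_cycles (Suc h) (s + (a - 1)) as)) = {}"
    unfolding set_comb_cycles using 2 by auto
  ultimately show ?case using 2 by simp
qed simp

text \<open>A tail point is preceded in its cycle either by the point just below it or by the head,
  and all heads lie below \<open>s\<close>.\<close>

lemma comb_cycles_ascending: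
  assumes "h + length as \<le> s" "j \<in> {s..<s + (\<Sum>a\<leftarrow>as. a - 1)}"
  shows "\<exists>cs\<in>set (comb_cycles h s as). \<exists>k. Suc k < length cs \<and> cs ! Suc k = j \<and> cs ! k \<in> {h..<j}"
  using assms
proof (induction h s as rule: comb_cycles.induct)
  case (2 h s a as)
  show ?case
  proof (cases "j < s + (a - 1)")
    case True
    let ?cs = "h # [s..<s + (a - 1)]"
    have "Suc (j - s) < length ?cs" "?cs ! Suc (j - s) = j" using True 2 by auto
    moreover have "?cs ! (j - s) \<in> {h..<j}" using True 2 by (cases "j - s") auto
    ultimately show ?thesis by (intro bexI[of _ ?cs] exI[of _ "j - s"]) auto
  next
    case False
    then have "\<exists>cs\<in>set (comb_cycles (Suc h) (s + (a - 1)) as).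
        \<exists>k. Suc k < length cs \<and> cs ! Suc k = j \<and> cs ! k \<in> {Suc h..<j}"
      using 2 by simp
    then show ?thesis by fastforce
  qed
qed simp

text \<open>An upper bound on the cardinality spares any proof that the constructed generators are
  distinct; the reverse inequality comes from \<open>generating_set_lower_bound\<close>.\<close>

definition generated_by :: "nat multiset \<Rightarrow> nat \<Rightarrow> nat \<Rightarrow> bool" where
  "generated_by A t n \<longleftrightarrow> (\<exists>G. finite G \<and> card G \<le> t \<and> G \<subseteq> ext_conj_class A n \<and>
     generate (sym_group n) G = carrier (sym_group n))"

text \<open>The new generator is a comb with heads 1, ..., m, where m is the size of
  \<open>A\<close>. The bound on \<open>n\<close> leaves a gap between heads and tails, and its
  first point m + 1 is the fixed old point that \<open>generate_sym_group_extend\<close> asks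
  for.\<close>

lemma generated_by_extend:
  assumes A: "\<forall>a\<in>#A. 2 \<le> a" and gen: "generated_by A t n"
    and n: "2 * cval A + 1 \<le> n" and r: "0 < r" "r \<le> cval A"
  shows "generated_by A (Suc t) (n + r)"
proof -
  obtain as where as: "mset as = A" using ex_mset by blast
  let ?c = "cval A" and ?m = "length as"
  \<comment> \<open>The tails occupy the last \<open>cval A\<close> points up to
    \<open>n + r\<close>; when \<open>r < cval A\<close> they also run over some old points.\<close>
  let ?s = "n + r - ?c + 1"
  have c: "(\<Sum>a\<leftarrow>as. a - 1) = ?c" using cval_mset[of as] as by simp
  have m: "?m \<le> ?c" using size_le_cval[OF A] as by auto
  have as2: "\<forall>a\<in>set as. 2 \<le> a" using A as by auto
  define css where "css = comb_cycles 1 ?s as"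
  have hs: "1 + ?m \<le> ?s" using m n r by linarith
  have dist: "distinct (concat css)" unfolding css_def by (rule distinct_comb_cycles[OF hs])
  have len: "map length css = as" unfolding css_def by (rule length_comb_cycles[OF as2])
  then have len2: "\<forall>cs\<in>set css. 2 \<le> length cs" using as2 by auto
  have supp: "set (concat css) = {1..<1 + ?m} \<union> {?s..<?s + ?c}"
    unfolding css_def set_comb_cycles c ..
  let ?p = "cycle_product css"
  have p: "?p \<in> ext_conj_class A (n + r)"
    using dist len2 len as supp m n r by (intro cycle_product_in_ext_conj_class) auto
  obtain G where G: "finite G" "card G \<le> t" "G \<subseteq> ext_conj_class A n"
    "generate (sym_group n) G = carrier (sym_group n)"
    using gen by (auto simp: generated_by_def)
  have "generate (sym_group (n + r)) (insert ?p G) = carrier (sym_group (n + r))"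
  proof (rule generate_sym_group_extend[OF G(4)])
    show "G \<subseteq> carrier (sym_group n)" using G(3) ext_conj_class_subset_carrier by blast
    show "?p \<in> carrier (sym_group (n + r))" using p ext_conj_class_subset_carrier by blast
    show "1 + ?m \<in> {1..n}" using m n r by auto
    have "1 + ?m < ?s" using m n r by linarith
    then have "1 + ?m \<notin> set (concat css)" unfolding supp by auto
    then show "?p (1 + ?m) = 1 + ?m" by (rule cycle_product_outside)
  next
    fix j assume "j \<in> {n<..n + r}"
    then have "j \<in> {?s..<?s + (\<Sum>a\<leftarrow>as. a - 1)}" unfolding c using r n by auto
    from comb_cycles_ascending[OF hs this] obtain cs k where
      cs: "cs \<in> set css" "Suc k < length cs" "cs ! Suc k = j" "cs ! k \<in> {1..<j}"
      unfolding css_def by blast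
    have "?p (cs ! k) = cycle_of_list cs (cs ! k)"
      using cs by (intro cycle_product_apply[OF dist]) auto
    also have "\<dots> = j" using cs dist by (subst cycle_of_list_nth_Suc) (auto simp: distinct_concat_iff)
    finally show "\<exists>i\<in>{1..<j}. ?p i = j" using cs(4) by blast
  qed simp
  moreover have "card (insert ?p G) \<le> Suc t" using G(1,2) by (simp add: card_insert_if)
  moreover have "insert ?p G \<subseteq> ext_conj_class A (n + r)"
    using p G(3) ext_conj_class_mono[of n "n + r" A] by auto
  ultimately show ?thesis
    unfolding generated_by_def using G(1) by (intro exI[of _ "insert ?p G"]) simp
qed

text \<open>The assumptions \<open>le\<close> and \<open>gt\<close> say that \<open>t\<close> is the
  ceiling of (n - 1) / c(A). Full steps of c(A) points lead from the base to \<open>t - 1\<close>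
  generators, and a last step of between 1 and c(A) points ends exactly at \<open>n\<close>.\<close>

lemma generated_by_from_base:
  assumes A: "\<forall>a\<in>#A. 2 \<le> a" and "0 < cval A" and base: "generated_by A T (T * cval A + 1)" and T: "2 \<le> T"
    and n: "T * cval A + 1 \<le> n" and le: "n \<le> t * cval A + 1" and gt: "t * cval A + 1 < n + cval A"
  shows "generated_by A t n"
proof -
  let ?c = "cval A"
  have extend: "generated_by A (Suc k) (k * ?c + 1 + r)" if "generated_by A k (k * ?c + 1)" "T \<le> k"
    "0 < r" "r \<le> ?c" for k r
  proof (rule generated_by_extend[OF A that(1) _ that(3,4)])
    show "2 * ?c + 1 \<le> k * ?c + 1" using T that(2) mult_le_mono1[of 2 k ?c] by simp
  qed
  have exact: "generated_by A k (k * ?c + 1)" if "T \<le> k" for k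
    using that
  proof (induction k rule: dec_induct)
    case (step k)
    then show ?case using \<open>0 < ?c\<close> extend[of k ?c] by (simp add: algebra_simps)
  qed (use base in simp)
  have "T * ?c \<le> t * ?c" using n le by linarith
  then have "T \<le> t" using \<open>0 < ?c\<close> by simp
  show ?thesis
  proof (cases "T = t")
    case True
    then show ?thesis using base n le by simp
  next
    case False
    then obtain k where k: "t = Suc k" "T \<le> k" using \<open>T \<le> t\<close> by (cases t) auto
    define r where "r = n - (k * ?c + 1)"
    have "0 < r" "r \<le> ?c" "k * ?c + 1 + r = n" using gt le unfolding r_def k(1) by auto
    then show ?thesis using extend[OF exact[OF k(2)] k(2), of r] k(1) by simp
  qed
qed

section \<open>Generators along a path of intervals\<close>


text \<open>
  A word of pairs (colour, length) is laid out as a path of intervals, each one starting at the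
  last point of its predecessor; the intervals with a colour in \<open>K\<close> are retained.
\<close>
fun path_cycles :: "nat set \<Rightarrow> nat \<Rightarrow> (nat \<times> nat) list \<Rightarrow> nat list list" where
  "path_cycles K s [] = []"
| "path_cycles K s ((k, a) # ws) =
     (if k \<in> K then [[s..<s + a]] else []) @ path_cycles K (s + (a - 1)) ws"

lemma length_path_cycles:
  "map length (path_cycles K s ws) = map snd (filter (\<lambda>w. fst w \<in> K) ws)"
  by (induction K s ws rule: path_cycles.induct) auto

lemma path_cycles_bounds:
  assumes "\<forall>w\<in>set ws. 2 \<le> snd w" "x \<in> set (concat (path_cycles K s ws))"
  shows "s \<le> x" "x \<le> s + (\<Sum>w\<leftarrow>ws. snd w - 1)"
proof -
  have "s \<le> x \<and> x \<le> s + (\<Sum>w\<leftarrow>ws. snd w - 1)"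
    using assms
  proof (induction K s ws rule: path_cycles.induct)
    case (2 K s k a ws)
    show ?case
    proof (cases "x \<in> set (concat (path_cycles K (s + (a - 1)) ws))")
      case True
      then show ?thesis using 2 by auto
    next
      case False
      then have "x \<in> {s..<s + a}" using 2(3) by (simp split: if_splits)
      then show ?thesis by auto
    qed
  qed simp
  then show "s \<le> x" "x \<le> s + (\<Sum>w\<leftarrow>ws. snd w - 1)" by auto
qed

text \<open>The first interval is skipped and has at least two points, so its successor starts
  beyond \<open>s\<close>.\<close>

lemma path_cycles_bound_strict:
  assumes "\<forall>w\<in>set ws. 2 \<le> snd w" "x \<in> set (concat (path_cycles K s ws))"
    and "fst (hd ws) \<notin> K"
  shows "s < x"
proof (cases ws)
  case (Cons w ws')
  obtain k a where w: "w = (k, a)" by force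
  have "x \<in> set (concat (path_cycles K (s + (a - 1)) ws'))" using assms w Cons by auto
  then show ?thesis using path_cycles_bounds(1)[of ws' x K "s + (a - 1)"] assms w Cons by auto
qed (use assms in simp)

text \<open>Only consecutive intervals of the path share a point, so it is enough that no two
  consecutive ones are both retained.\<close>

lemma distinct_path_cycles:
  assumes "\<forall>w\<in>set ws. 2 \<le> snd w" "successively (\<lambda>p q. \<not> (fst p \<in> K \<and> fst q \<in> K)) ws"
  shows "distinct (concat (path_cycles K s ws))"
  using assms
proof (induction K s ws rule: path_cycles.induct)
  case (2 K s k a ws)
  let ?rest = "path_cycles K (s + (a - 1)) ws"
  have IH: "distinct (concat ?rest)" using 2 by (auto simp: successively_Cons)
  have "{s..<s + a} \<inter> set (concat ?rest) = {}" if "k \<in> K"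
  proof (cases "ws = []")
    case False
    then have "fst (hd ws) \<notin> K" using 2(3) that by (simp add: successively_Cons)
    then show ?thesis
      using path_cycles_bound_strict[of ws _ K "s + (a - 1)"] 2(2) by fastforce
  qed simp
  then show ?case using IH by auto
qed simp

lemma path_cycles_disjoint:
  assumes "distinct (concat (path_cycles (K \<union> L) s ws))" "K \<inter> L = {}"
  shows "set (concat (path_cycles K s ws)) \<inter> set (concat (path_cycles L s ws)) = {}"
proof -
  have sub: "set (concat (path_cycles K s ws)) \<subseteq> set (concat (path_cycles (K \<union> L) s ws))" for K L s ws
    by (induction K s ws rule: path_cycles.induct) auto
  show ?thesis
    using assms
  proof (induction ws arbitrary: s)
    case (Cons w ws)
    obtain k a where w: "w = (k, a)" by force
    let ?s = "s + (a - 1)"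
    have IH: "set (concat (path_cycles K ?s ws)) \<inter> set (concat (path_cycles L ?s ws)) = {}"
      using Cons w by (intro Cons.IH) (auto split: if_splits)
    have "{s..<s + a} \<inter> set (concat (path_cycles (K \<union> L) ?s ws)) = {}" if "k \<in> K \<union> L"
      using Cons.prems(1) that unfolding w by auto
    then have "{s..<s + a} \<inter> set (concat (path_cycles K ?s ws)) = {}"
      "{s..<s + a} \<inter> set (concat (path_cycles L ?s ws)) = {}" if "k \<in> K \<union> L"
      using that sub[of K ?s ws L] sub[of L ?s ws K] unfolding Un_commute[of L K] by blast+
    moreover have "set (concat (path_cycles M s (w # ws))) =
        (if k \<in> M then {s..<s + a} else {}) \<union> set (concat (path_cycles M ?s ws))" for M
      unfolding w by simp
    ultimately show ?case using IH Cons.prems(2) by auto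
  qed simp
qed

text \<open>Every point after the start is a non-initial point of some interval, which therefore
  contains its predecessor too; the corresponding cycle sends \<open>j - 1\<close> to
  \<open>j\<close>.\<close>

lemma path_cycles_ascending:
  assumes "\<forall>w\<in>set ws. 2 \<le> snd w" "j \<in> {s<..s + (\<Sum>w\<leftarrow>ws. snd w - 1)}"
  shows "\<exists>k\<in>fst ` set ws. \<exists>u v. [u..<v] \<in> set (path_cycles {k} s ws) \<and> u < j \<and> j < v"
  using assms
proof (induction ws arbitrary: s)
  case (Cons w ws)
  obtain k a where w: "w = (k, a)" by force
  show ?case
  proof (cases "j < s + a")
    case True
    then show ?thesis unfolding w using Cons.prems by auto
  next
    case False
    then have "\<exists>k\<in>fst ` set ws. \<exists>u v. [u..<v] \<in> set (path_cycles {k} (s + (a - 1)) ws) \<and> u < j \<and> j < v"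
      using Cons.prems w by (intro Cons.IH) auto
    then obtain k' u v where "k' \<in> fst ` set ws"
      "[u..<v] \<in> set (path_cycles {k'} (s + (a - 1)) ws)" "u < j" "j < v" by blast
    then show ?thesis unfolding w by (intro bexI[of _ k'] exI[of _ u] exI[of _ v]) auto
  qed
qed simp

text \<open>
  Colours \<open>0\<close> and \<open>1\<close> meet only at the common point \<open>a\<close> of the first two intervals, and the
  point \<open>1\<close> is moved by colour \<open>0\<close> alone.
\<close>
lemma generated_by_path:
  assumes ws: "ws = (0, a) # (1, a) # rest" and len: "\<forall>w\<in>set ws. 2 \<le> snd w"
    and colours: "\<forall>w\<in>set ws. fst w < T"
    and type: "\<And>k. k < T \<Longrightarrow> mset (map snd (filter (\<lambda>w. fst w = k) ws)) = A"
    and adj: "successively (\<lambda>p q. fst p \<noteq> fst q) ws"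
    and adj01: "successively (\<lambda>p q. \<not> (fst p \<in> {0, 1} \<and> fst q \<in> {0, 1})) ((1, a) # rest)"
    and odd: "odd (cval A)"
    and n: "n = 1 + (\<Sum>w\<leftarrow>ws. snd w - 1)"
  shows "generated_by A T n"
proof -
  define css where "css k = path_cycles {k} 1 ws" for k
  define g where "g k = cycle_product (css k)" for k
  have T: "0 < T" "1 < T" using colours ws by auto
  have a2: "2 \<le> a" using len ws by simp
  have dist: "distinct (concat (css k))" for k
    unfolding css_def using adj by (intro distinct_path_cycles[OF len] successively_mono[OF adj]) auto
  have lens: "mset (map length (css k)) = A" if "k < T" for k
    unfolding css_def length_path_cycles using type[OF that] by simp
  have len_css: "2 \<le> length cs" if "cs \<in> set (css k)" for k cs
  proof -
    have "length cs \<in> set (map length (css k))" using that by simp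
    then show ?thesis unfolding css_def length_path_cycles using len by auto
  qed
  have g_in: "g k \<in> ext_conj_class A n" if "k < T" for k
    unfolding g_def
  proof (rule cycle_product_in_ext_conj_class[OF dist _ _ lens[OF that]])
    show "set (concat (css k)) \<subseteq> {1..n}"
      using path_cycles_bounds[OF len, of _ "{k}" 1] unfolding n css_def by (meson atLeastAtMost_iff subsetI)
  qed (use len_css in blast)
  have odd_g: "\<not> evenperm (g k)" if "k < T" for k
  proof -
    have "(\<Sum>cs\<leftarrow>css k. length cs - 1) = cval A"
      using cval_mset[of "map length (css k)"] lens[OF that] by (simp add: comp_def)
    then show ?thesis unfolding g_def evenperm_cycle_product[OF dist] using odd by simp
  qed
  \<comment> \<open>The first interval ends at \<open>a\<close>, where the rest of the path
    begins.\<close>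
  have css_rest: "css k = (if k = 0 then [[1..<1 + a]] else []) @ path_cycles {k} a ((1, a) # rest)" for k
    unfolding css_def ws using a2 by simp
  have len_rest: "\<forall>w\<in>set ((1, a) # rest). 2 \<le> snd w" using len ws by simp
  have gen: "generate (sym_group n) (g ` {..<T}) = carrier (sym_group n)"
  proof (rule generate_sym_group_if_single_common_point[of _ _ "g 0" "g 1" a])
    show "g ` {..<T} \<subseteq> carrier (sym_group n)" using g_in ext_conj_class_subset_carrier by blast
    show "\<not> evenperm h" if "h \<in> g ` {..<T}" for h using that odd_g by auto
    show "g 0 \<in> g ` {..<T}" "g 1 \<in> g ` {..<T}" using T by auto
    \<comment> \<open>Being the last point of the first interval, \<open>a\<close> is sent back to
      \<open>1\<close>.\<close>
    have "g 0 a = cycle_of_list [1..<1 + a] a"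
      unfolding g_def using a2 by (intro cycle_product_apply[OF dist]) (auto simp: css_rest)
    also have "\<dots> = 1" using cycle_of_list_last[of "[1..<1 + a]"] a2 by (simp add: last_upt hd_upt)
    finally show g0: "g 0 a = 1" .
    then show "g 0 a \<noteq> a" using a2 by simp
    have "g 1 a = cycle_of_list [a..<a + a] a"
      unfolding g_def using a2 by (intro cycle_product_apply[OF dist]) (auto simp: css_rest)
    also have "\<dots> = Suc a" using a2 by (intro cycle_of_list_upt_Suc) auto
    finally show "g 1 a \<noteq> a" by simp
    \<comment> \<open>From the second interval on, colours 0 and 1 are never adjacent and so have
      disjoint supports. A common point thus lies in the first interval, hence is at most
      \<open>a\<close>, while colour 1 occurs only from \<open>a\<close> on.\<close>
    show "i = a" if "g 0 i \<noteq> i" "g 1 i \<noteq> i" for i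
    proof -
      have i0: "i \<in> set (concat (css 0))" and i1: "i \<in> set (concat (css 1))"
        using that cycle_product_outside unfolding g_def by blast+
      have i1: "i \<in> set (concat (path_cycles {1} a ((1, a) # rest)))" using i1 by (simp add: css_rest)
      have "distinct (concat (path_cycles ({0} \<union> {1}) a ((1, a) # rest)))"
        using distinct_path_cycles[OF len_rest adj01] by (simp only: insert_is_Un[symmetric])
      then have "i \<notin> set (concat (path_cycles {0} a ((1, a) # rest)))"
        using path_cycles_disjoint[of "{0}" "{1}" a "(1, a) # rest"] i1 by auto
      then have "i \<le> a" using i0 by (auto simp: css_rest)
      then show ?thesis using path_cycles_bounds(1)[OF len_rest i1] by simp
    qed
    show "h 1 = 1" if h: "h \<in> g ` {..<T}" "h \<noteq> g 0" for h
    proof -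
      obtain k where k: "h = g k" "k \<noteq> 0" using h by auto
      have "1 \<notin> set (concat (css k))"
        using path_cycles_bounds(1)[OF len_rest, of 1 "{k}" a] a2 k(2) by (auto simp: css_rest)
      then show ?thesis unfolding k(1) g_def by (rule cycle_product_outside)
    qed
    show "\<exists>h\<in>g ` {..<T}. \<exists>i\<in>{1..<j}. h i = j" if j: "j \<in> {2..n}" for j
    proof -
      have "j \<in> {1<..1 + (\<Sum>w\<leftarrow>ws. snd w - 1)}" using j n by auto
      from path_cycles_ascending[OF len this] obtain k u v where
        k: "k \<in> fst ` set ws" and uv: "[u..<v] \<in> set (css k)" "u < j" "j < v"
        unfolding css_def by blast
      have "g k (j - 1) = cycle_of_list [u..<v] (j - 1)"
        unfolding g_def using uv by (intro cycle_product_apply[OF dist]) auto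
      also have "\<dots> = j" using cycle_of_list_upt_Suc[of u "j - 1" v] uv by simp
      finally show ?thesis using k colours j by (intro bexI[of _ "g k"] bexI[of _ "j - 1"]) auto
    qed
  qed
  show ?thesis
    unfolding generated_by_def using gen g_in card_image_le[of "{..<T}" g]
    by (intro exI[of _ "g ` {..<T}"]) auto
qed

section \<open>Interleaved words: four generators in general, two for a single cycle\<close>

fun weave :: "nat \<Rightarrow> nat \<Rightarrow> nat list \<Rightarrow> (nat \<times> nat) list" where
  "weave c d [] = []"
| "weave c d [x] = [(c, x)]"
| "weave c d (x # y # zs) = (c, x) # (d, y) # weave c d (y # zs)"

lemma weave_eq_Nil_iff [simp]: "weave c d as = [] \<longleftrightarrow> as = []"
  by (cases "(c, d, as)" rule: weave.cases) auto

lemma hd_weave: "as \<noteq> [] \<Longrightarrow> hd (weave c d as) = (c, hd as)"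
  by (cases "(c, d, as)" rule: weave.cases) auto

lemma last_weave: "as \<noteq> [] \<Longrightarrow> last (weave c d as) = (c, last as)"
  by (induction c d as rule: weave.induct) auto

lemma set_weave: "w \<in> set (weave c d as) \<Longrightarrow> fst w \<in> {c, d} \<and> snd w \<in> set as"
  by (induction c d as rule: weave.induct) auto

text \<open>Colour \<open>c\<close> receives a full set of cycles, colour \<open>d\<close> all but
  the first; that missing cycle is one of the two opening letters of the path.\<close>

lemma filter_weave:
  "c \<noteq> d \<Longrightarrow> map snd (filter (\<lambda>w. fst w = k) (weave c d as)) =
     (if k = c then as else if k = d then tl as else [])"
  by (induction c d as rule: weave.induct) auto

lemma successively_weave:
  "P c d \<Longrightarrow> P d c \<Longrightarrow> successively (\<lambda>p q. P (fst p) (fst q)) (weave c d as)"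
  by (induction c d as rule: weave.induct) (auto simp: successively_Cons hd_weave)

lemma sum_weave:
  "(\<Sum>w\<leftarrow>weave c d as. snd w - 1) = (\<Sum>a\<leftarrow>as. a - 1) + (\<Sum>a\<leftarrow>tl as. a - 1)"
  by (induction c d as rule: weave.induct) auto

text \<open>Colours 2 and 3 get their cycles from the two weaves alone, colours 0 and 1 from an
  opening letter and a weave. Each colour contributes \<open>cval A\<close> steps of the path,
  whence 4 c(A) + 1 points.\<close>

lemma generated_by_4:
  assumes A: "\<forall>a\<in>#A. 2 \<le> a" and odd: "odd (cval A)"
  shows "generated_by A 4 (4 * cval A + 1)"
proof -
  obtain as where as: "mset as = A" using ex_mset by blast
  have "as \<noteq> []" using odd as by (auto simp: cval_def)
  then obtain a bs where ab: "as = a # bs" by (cases as) auto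
  have as2: "\<forall>b\<in>set as. 2 \<le> b" using A as by auto
  let ?rest = "weave 2 0 as @ weave 3 1 as"
  \<comment> \<open>The six colour pairs are all adjacencies after the opening letter 0. A general
    \<open>P\<close> serves both adjacency conditions of \<open>generated_by_path\<close>.\<close>
  have succ: "successively (\<lambda>p q. P (fst p) (fst q)) ((1, a) # ?rest)"
    if "P 2 0" "P 0 2" "P 3 1" "P 1 3" "P 1 2" "P 2 3" for P
    using that successively_weave[of P 2 0 as] successively_weave[of P 3 1 as] ab
    by (auto simp: successively_Cons successively_append_iff hd_weave last_weave hd_append)
  show ?thesis
  proof (rule generated_by_path[OF refl, of a ?rest])
    show "\<forall>w\<in>set ((0, a) # (1, a) # ?rest). 2 \<le> snd w"
      using as2 ab set_weave by (fastforce simp del: split_paired_All)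
    show "\<forall>w\<in>set ((0, a) # (1, a) # ?rest). fst w < 4"
      using set_weave by fastforce
    show "mset (map snd (filter (\<lambda>w. fst w = k) ((0, a) # (1, a) # ?rest))) = A" if "k < 4" for k
    proof -
      have "k = 0 \<or> k = 1 \<or> k = 2 \<or> k = 3" using that by auto
      then have "map snd (filter (\<lambda>w. fst w = k) ((0, a) # (1, a) # ?rest)) = as"
        using ab by (auto simp: filter_weave)
      then show ?thesis using as by simp
    qed
    show "successively (\<lambda>p q. fst p \<noteq> fst q) ((0, a) # (1, a) # ?rest)"
      using succ[of "(\<noteq>)"] by simp
    show "successively (\<lambda>p q. \<not> (fst p \<in> {0, 1} \<and> fst q \<in> {0, 1})) ((1, a) # ?rest)"
      by (rule succ) auto
    show "4 * cval A + 1 = 1 + (\<Sum>w\<leftarrow>(0, a) # (1, a) # ?rest. snd w - 1)"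
      using cval_mset[of as] as ab by (simp add: sum_weave del: One_nat_def)
  qed (rule odd)
qed

text \<open>With one cycle per generator nothing is left to weave: two \<open>k\<close>-cycles
  sharing one point suffice.\<close>

lemma generated_by_2:
  assumes "2 \<le> k" "even k"
  shows "generated_by {#k#} 2 (2 * cval {#k#} + 1)"
proof (rule generated_by_path[OF refl, of k "[]"])
  show "mset (map snd (filter (\<lambda>w. fst w = i) [(0, k), (1, k)])) = {#k#}" if "i < 2" for i :: nat
    using that by (cases i) auto
qed (use assms in \<open>auto simp: cval_def\<close>)

section \<open>The number of generators\<close>


text \<open>The pairs in \<open>zip cs (tl cs)\<close> are the edges of a path through the cycle.
  The closing edge is left out, which keeps the number of edges at
  \<open>length cs - 1\<close>.\<close>

lemma cycle_of_list_invariant: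
  assumes "\<forall>(a, b)\<in>set (zip cs (tl cs)). f a = f b"
  shows "f (cycle_of_list cs x) = f x"
  using assms
proof (induction cs arbitrary: x rule: cycle_of_list.induct)
  case (1 i j cs)
  then have "f (transpose i j y) = f y" for y by (simp add: transpose_def)
  then show ?case using 1 by simp
qed simp_all

lemma cycle_product_invariant:
  assumes "\<forall>(a, b)\<in>set (concat (map (\<lambda>cs. zip cs (tl cs)) css)). f a = f b"
  shows "f (cycle_product css x) = f x"
  using assms
proof (induction css)
  case (Cons cs css)
  have "f (cycle_of_list cs (cycle_product css x)) = f (cycle_product css x)"
    using Cons.prems by (intro cycle_of_list_invariant) auto
  then show ?case using Cons by simp
qed simp

text \<open>The forest of a permutation enters the counting only through the functions that are
  constant along its edges.\<close>

lemma ext_conj_class_edges: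
  assumes "p \<in> ext_conj_class A n"
  shows "\<exists>E. finite E \<and> card E \<le> cval A \<and>
    (\<forall>(f :: nat \<Rightarrow> nat) x. (\<forall>(a, b)\<in>E. f a = f b) \<longrightarrow> f (p x) = f x)"
proof -
  obtain css where p: "p = cycle_product css" and css: "mset (map length css) = A"
    using assms by (auto simp: ext_conj_class_def cycle_product_def)
  let ?es = "concat (map (\<lambda>cs. zip cs (tl cs)) css)"
  have "card (set ?es) \<le> length ?es" by (rule card_length)
  also have "\<dots> = (\<Sum>cs\<leftarrow>css. length cs - 1)"
    by (simp add: length_concat comp_def)
  also have "\<dots> = cval A" using cval_mset[of "map length css"] css by (simp add: comp_def)
  finally have "card (set ?es) \<le> cval A" .
  moreover have "f (p x) = f x" if "\<forall>(a, b)\<in>set ?es. f a = f b" for f :: "nat \<Rightarrow> nat" and x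
    unfolding p by (rule cycle_product_invariant[OF that])
  ultimately show ?thesis by (intro exI[of _ "set ?es"] conjI allI impI) simp_all
qed

text \<open>The values of \<open>f\<close> label connected components. A further edge merges the
  fibre over \<open>f a\<close> into the one over \<open>f b\<close>, which costs at most one
  value.\<close>

lemma exists_map_constant_on_edges:
  fixes E :: "(nat \<times> nat) set"
  assumes "finite E"
  shows "\<exists>f :: nat \<Rightarrow> nat. (\<forall>(a, b)\<in>E. f a = f b) \<and> n \<le> card (f ` {1..n}) + card E"
  using assms
proof induction
  case empty
  then show ?case by (intro exI[of _ "\<lambda>i. i"]) simp
next
  case (insert e E)
  obtain a b where e: "e = (a, b)" by force
  obtain f :: "nat \<Rightarrow> nat" where f: "\<forall>(a, b)\<in>E. f a = f b" "n \<le> card (f ` {1..n}) + card E"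
    using insert.IH by blast
  define h where "h i = (if f i = f a then f b else f i)" for i
  have "f ` {1..n} \<subseteq> insert (f a) (h ` {1..n})" by (auto simp: h_def)
  then have "card (f ` {1..n}) \<le> card (insert (f a) (h ` {1..n}))" by (intro card_mono) auto
  also have "\<dots> \<le> Suc (card (h ` {1..n}))" by (simp add: card_insert_if)
  finally have "n \<le> card (h ` {1..n}) + card (insert e E)" using f(2) insert.hyps by simp
  moreover have "\<forall>(a, b)\<in>insert e E. h a = h b" using f(1) e by (auto simp: h_def)
  ultimately show ?case by blast
qed

text \<open>Connecting \<open>n\<close> points by \<open>card G\<close> forests with \<open>cval A\<close> edges each takes \<open>n - 1\<close> edges.\<close>
lemma generating_set_lower_bound:
  assumes G: "G \<subseteq> ext_conj_class A n" and gen: "generate (sym_group n) G = carrier (sym_group n)"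
  shows "n \<le> card G * cval A + 1"
proof (cases "n = 0")
  case False
  have Gc: "G \<subseteq> carrier (sym_group n)" using G ext_conj_class_subset_carrier by blast
  then have fin: "finite G"
    using finite_permutations[of "{1..n}"] finite_subset by (auto simp: sym_group_def)
  have "\<forall>p\<in>G. \<exists>E. finite E \<and> card E \<le> cval A \<and>
      (\<forall>(f :: nat \<Rightarrow> nat) x. (\<forall>(a, b)\<in>E. f a = f b) \<longrightarrow> f (p x) = f x)"
    using G by (intro ballI ext_conj_class_edges) (rule subsetD)
  from bchoice[OF this] obtain E where E: "\<forall>p\<in>G. finite (E p) \<and> card (E p) \<le> cval A \<and>
      (\<forall>(f :: nat \<Rightarrow> nat) x. (\<forall>(a, b)\<in>E p. f a = f b) \<longrightarrow> f (p x) = f x)" ..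
  have "card (\<Union>p\<in>G. E p) \<le> (\<Sum>p\<in>G. card (E p))" by (rule card_UN_le[OF fin])
  also have "\<dots> \<le> card G * cval A" using sum_bounded_above[of G "\<lambda>p. card (E p)"] E by simp
  finally have card: "card (\<Union>p\<in>G. E p) \<le> card G * cval A" .
  obtain f :: "nat \<Rightarrow> nat" where f: "\<forall>(a, b)\<in>(\<Union>p\<in>G. E p). f a = f b"
    "n \<le> card (f ` {1..n}) + card (\<Union>p\<in>G. E p)"
    using exists_map_constant_on_edges[of "\<Union>p\<in>G. E p" n] fin E by auto
  have inv_G: "f (p x) = f x" if "p \<in> G" for p x
  proof -
    have "\<forall>(a, b)\<in>E p. f a = f b" using f(1) that by blast
    then show ?thesis using E that by blast
  qed
  have inv_gen: "f (p x) = f x" if "p \<in> generate (sym_group n) G" for p x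
    using that
  proof (induction arbitrary: x)
    case one
    show ?case by (simp add: sym_group_one)
  next
    case (incl h)
    then show ?case by (rule inv_G)
  next
    case (inv h)
    then have h: "h permutes {1..n}" "inv\<^bsub>sym_group n\<^esub> h = inv' h"
      using Gc by (auto simp: sym_group_carrier)
    have "f (h (inv' h x)) = f (inv' h x)" using inv_G inv by blast
    then show ?case using h permutes_inverses(1)[OF h(1)] by simp
  next
    case (eng h1 h2)
    then show ?case by (simp add: sym_group_mult)
  qed
  \<comment> \<open>Now \<open>f\<close> is invariant under all of S_n, in particular under (1 i),
    so it has only one value on the \<open>n\<close> points.\<close>
  have "f i = f 1" if "i \<in> {1..n}" for i
  proof -
    have "transpose 1 i permutes {1..n}" using that by (intro permutes_swap_id) auto
    then have "transpose 1 i \<in> generate (sym_group n) G" unfolding gen by (simp add: sym_group_carrier)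
    from inv_gen[OF this, of 1] show ?thesis by simp
  qed
  then have "f ` {1..n} \<subseteq> {f 1}" by blast
  then have "card (f ` {1..n}) \<le> card {f 1}" by (rule card_mono[rotated]) simp
  then have "card (f ` {1..n}) \<le> 1" by simp
  then show ?thesis using f(2) card by linarith
qed simp

text \<open>With \<open>t\<close> the ceiling, \<open>le\<close> and \<open>gt\<close> are its two
  defining inequalities cleared of denominators. They allow the construction with \<open>t\<close>
  generators, and edge counting shows that no generating set is smaller.\<close>

lemma f_gen_eq:
  assumes A: "\<forall>a\<in>#A. 2 \<le> a" and pos: "0 < cval A" and base: "generated_by A T (T * cval A + 1)"
    and T: "2 \<le> T" and n: "T * cval A + 1 \<le> n"
  shows "f_gen A n = enat (nat \<lceil>(real n - 1) / real (cval A)\<rceil>)"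
proof -
  let ?c = "cval A" and ?x = "(real n - 1) / real (cval A)"
  define t where "t = nat \<lceil>?x\<rceil>"
  have x: "0 \<le> ?x" using n by simp
  then have t: "?x \<le> real t" "real t < ?x + 1"
    unfolding t_def using ceiling_correct[of ?x] by auto
  have "real n \<le> real t * real ?c + 1" using t(1) pos by (simp add: field_simps)
  then have le: "n \<le> t * ?c + 1" by (metis of_nat_1 of_nat_add of_nat_le_iff of_nat_mult)
  have "real t * real ?c + 1 < real n + real ?c" using t(2) pos by (simp add: field_simps)
  then have gt: "t * ?c + 1 < n + ?c" by (metis of_nat_1 of_nat_add of_nat_less_iff of_nat_mult)
  obtain G where G: "card G \<le> t" "G \<subseteq> ext_conj_class A n"
    "generate (sym_group n) G = carrier (sym_group n)"
    using generated_by_from_base[OF A pos base T n le gt] by (auto simp: generated_by_def)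
  show ?thesis
    unfolding f_gen_def t_def[symmetric]
  proof (rule antisym)
    show "(INF G \<in> {G. G \<subseteq> ext_conj_class A n \<and> generate (sym_group n) G = carrier (sym_group n)}.
        enat (card G)) \<le> enat t"
      using G by (intro INF_lower2[of G]) auto
    show "enat t \<le> (INF G \<in> {G. G \<subseteq> ext_conj_class A n \<and>
        generate (sym_group n) G = carrier (sym_group n)}. enat (card G))"
    proof (rule INF_greatest)
      fix G assume "G \<in> {G. G \<subseteq> ext_conj_class A n \<and> generate (sym_group n) G = carrier (sym_group n)}"
      then have "n \<le> card G * ?c + 1" using generating_set_lower_bound by blast
      then have "real n \<le> real (card G * ?c + 1)" by (simp only: of_nat_le_iff)
      then have "?x \<le> real (card G)" using pos by (simp add: field_simps)
      then have "t \<le> card G" unfolding t_def by (simp add: ceiling_le_iff)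
      then show "enat t \<le> enat (card G)" by simp
    qed
  qed
qed

lemma X0_le:
  assumes "\<forall>a\<in>#A. 2 \<le> a" "0 < cval A" "generated_by A T (T * cval A + 1)" "2 \<le> T"
  shows "X0 A \<le> T * cval A + 1"
  unfolding X0_def using f_gen_eq[OF assms] by (intro Least_le) simp

section \<open>Values of cyclotomic polynomials\<close>

lemma cis_primitive_root_of_unity:
  assumes "0 < j"
  shows "cis (2 * pi / real j) \<in> primitive_roots_of_unity j"
proof -
  have "cis (2 * pi / real j) ^ i \<noteq> 1" if i: "0 < i" "i < j" for i
  proof
    assume "cis (2 * pi / real j) ^ i = 1"
    then have "cis (real i * (2 * pi / real j)) = 1" by (simp add: DeMoivre)
    then have "cos (real i * (2 * pi / real j)) = 1" by (metis cis.simps(1) one_complex.simps(1))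
    then obtain k :: int where "real i * (2 * pi / real j) = real_of_int k * 2 * pi"
      unfolding cos_one_2pi_int by blast
    then have "real i = real_of_int k * real j" using assms by (simp add: field_simps)
    then have "int i = k * int j" by (metis of_int_eq_iff of_int_mult of_int_of_nat_eq)
    then have "int j dvd int i" by simp
    then show False using i by (auto dest: dvd_imp_le)
  qed
  moreover have "cis (2 * pi / real j) ^ j = 1" using assms by (simp add: DeMoivre)
  ultimately show ?thesis by (auto simp: primitive_roots_of_unity_def)
qed

lemma cnj_primitive_root_of_unity:
  assumes "z \<in> primitive_roots_of_unity j"
  shows "cnj z \<in> primitive_roots_of_unity j"
proof -
  have "cnj z ^ i = 1 \<longleftrightarrow> z ^ i = 1" for i
    unfolding complex_cnj_power[symmetric] by (rule complex_cnj_one_iff)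
  then show ?thesis using assms by (simp add: primitive_roots_of_unity_def)
qed

lemma finite_primitive_roots_of_unity:
  assumes "0 < j"
  shows "finite (primitive_roots_of_unity j)"
  using finite_roots_unity[of j, where ?'a = complex] assms
  by (auto intro: finite_subset simp: primitive_roots_of_unity_def)

lemma norm_primitive_root_of_unity:
  assumes "z \<in> primitive_roots_of_unity j" "0 < j"
  shows "cmod z = 1"
  using assms power_eq_1_iff[of z j] by (auto simp: primitive_roots_of_unity_def)

lemma poly_cyclotomic: "poly (cyclotomic j) z = (\<Prod>\<zeta>\<in>primitive_roots_of_unity j. z - \<zeta>)"
  by (simp add: cyclotomic_def poly_prod)

text \<open>The primitive roots come in conjugate pairs, each contributing \<open>\<bar>x - \<zeta>\<bar>\<^sup>2\<close>.\<close>
lemma cyclotomic_lower_bound: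
  assumes j: "3 \<le> j" and x: "2 \<le> x"
  shows "\<exists>y :: real. poly (cyclotomic j) (of_real x) = of_real y \<and> (x - 1)\<^sup>2 \<le> y"
proof -
  let ?P = "primitive_roots_of_unity j"
  define U where "U = {z\<in>?P. 0 < Im z}"
  have fin: "finite U" unfolding U_def using finite_primitive_roots_of_unity[of j] j by simp
  \<comment> \<open>A real root of unity is 1 or -1, so its square is 1, which is excluded for order
    at least 3.\<close>
  have im: "Im z \<noteq> 0" if "z \<in> ?P" for z
  proof
    assume "Im z = 0"
    moreover have "cmod z = 1" using norm_primitive_root_of_unity[OF that] j by simp
    ultimately have "z = 1 \<or> z = - 1" by (auto simp: cmod_eq_Re complex_eq_iff)
    then have "z ^ 2 = 1" by auto
    then show False using that j by (auto simp: primitive_roots_of_unity_def)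
  qed
  have P: "?P = U \<union> cnj ` U"
  proof
    show "?P \<subseteq> U \<union> cnj ` U"
    proof
      fix z assume z: "z \<in> ?P"
      then consider "0 < Im z" | "0 < Im (cnj z)" using im[OF z] by fastforce
      then show "z \<in> U \<union> cnj ` U"
      proof cases
        case 2
        then have "cnj z \<in> U" using cnj_primitive_root_of_unity[OF z] by (simp add: U_def)
        then show ?thesis by (metis UnCI complex_cnj_cnj imageI)
      qed (use z in \<open>simp add: U_def\<close>)
    qed
    show "U \<union> cnj ` U \<subseteq> ?P" using cnj_primitive_root_of_unity by (auto simp: U_def)
  qed
  have disj: "U \<inter> cnj ` U = {}" by (auto simp: U_def)
  let ?x = "of_real x :: complex"
  have "poly (cyclotomic j) ?x = (\<Prod>\<zeta>\<in>U. ?x - \<zeta>) * (\<Prod>\<zeta>\<in>cnj ` U. ?x - \<zeta>)"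
    unfolding poly_cyclotomic P using fin disj by (intro prod.union_disjoint) auto
  also have "(\<Prod>\<zeta>\<in>cnj ` U. ?x - \<zeta>) = (\<Prod>\<zeta>\<in>U. cnj (?x - \<zeta>))"
    by (subst prod.reindex) (auto simp: inj_on_def)
  also have "(\<Prod>\<zeta>\<in>U. ?x - \<zeta>) * (\<Prod>\<zeta>\<in>U. cnj (?x - \<zeta>)) = of_real (\<Prod>\<zeta>\<in>U. (cmod (?x - \<zeta>))\<^sup>2)"
    unfolding prod.distrib[symmetric] of_real_prod by (intro prod.cong refl) (rule complex_norm_square[symmetric])
  finally have eq: "poly (cyclotomic j) ?x = of_real (\<Prod>\<zeta>\<in>U. (cmod (?x - \<zeta>))\<^sup>2)" .
  have factor: "(x - 1)\<^sup>2 \<le> (cmod (?x - \<zeta>))\<^sup>2" if "\<zeta> \<in> U" for \<zeta>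
  proof (rule power_mono)
    have "cmod ?x - cmod \<zeta> \<le> cmod (?x - \<zeta>)" by (rule norm_triangle_ineq2)
    moreover have "cmod \<zeta> = 1" using that j norm_primitive_root_of_unity by (auto simp: U_def)
    ultimately show "x - 1 \<le> cmod (?x - \<zeta>)" using x by simp
  qed (use x in simp)
  have one: "1 \<le> (x - 1)\<^sup>2" using power_mono[of 1 "x - 1" 2] x by simp
  \<comment> \<open>At least one conjugate pair exists: for \<open>j \<ge> 3\<close> the angle
    \<open>2 * pi / j\<close> lies strictly between 0 and \<open>pi\<close>. Its factor is kept, and
    all others are at least 1 because \<open>x \<ge> 2\<close>.\<close>
  obtain \<zeta> where "\<zeta> \<in> U"
  proof -
    have "0 < sin (2 * pi / real j)"
    proof (rule sin_gt_zero)
      show "2 * pi / real j < pi" using j by (simp add: field_simps)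
    qed (use j in simp)
    then have "cis (2 * pi / real j) \<in> U" using cis_primitive_root_of_unity[of j] j by (simp add: U_def)
    then show thesis by (rule that)
  qed
  then have "(\<Prod>\<zeta>\<in>U. (cmod (?x - \<zeta>))\<^sup>2) = (cmod (?x - \<zeta>))\<^sup>2 * (\<Prod>\<zeta>\<in>U - {\<zeta>}. (cmod (?x - \<zeta>))\<^sup>2)"
    using fin by (simp add: prod.remove)
  moreover have "1 \<le> (\<Prod>\<zeta>\<in>U - {\<zeta>}. (cmod (?x - \<zeta>))\<^sup>2)"
    using factor one by (intro prod_ge_1) (auto intro: order_trans)
  ultimately have "(cmod (?x - \<zeta>))\<^sup>2 \<le> (\<Prod>\<zeta>\<in>U. (cmod (?x - \<zeta>))\<^sup>2)"
    by (simp add: mult_le_cancel_left1)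
  then show ?thesis using eq factor[OF \<open>\<zeta> \<in> U\<close>] by (intro exI[of _ "\<Prod>\<zeta>\<in>U. (cmod (?x - \<zeta>))\<^sup>2"]) auto
qed

lemma poly_cyclotomic_2: "poly (cyclotomic 2) z = z + 1"
proof -
  have "primitive_roots_of_unity 2 = {-1}"
    by (auto simp: primitive_roots_of_unity_def power2_eq_1_iff less_2_cases_iff)
  then show ?thesis by (simp add: poly_cyclotomic)
qed

section \<open>The generation theorem\<close>

theorem theorem3p12:
  shows "(\<forall>A :: nat multiset. (\<forall>a\<in>#A. a \<ge> 2) \<and> odd (cval A) \<longrightarrow>
            (\<exists>X :: nat. 0 < X \<and>
               (\<forall>n\<ge>X. f_gen A n = enat (nat \<lceil>(real n - 1) / real (cval A)\<rceil>)))) \<and>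
         (\<forall>k :: nat. k \<ge> 2 \<and> even k \<longrightarrow> X0 {#k#} \<le> 2 * k - 1) \<and>
         (\<forall>k :: nat. k \<ge> 1 \<and> odd k \<longrightarrow>
            X0 (replicate_mset k 2) \<le> ((2 * k + 1) choose 2) + 1) \<and>
         (\<forall>A :: nat multiset. (\<forall>a\<in>#A. a \<ge> 2) \<and> odd (cval A) \<longrightarrow>
            (of_nat (X0 A) :: complex) \<le>
              of_nat (cval A) * poly (cyclotomic (2 * size A)) (of_nat (2 * size A)) + 1)"
proof (intro conjI allI impI)
  have X4: "X0 A \<le> 4 * cval A + 1" if "(\<forall>a\<in>#A. 2 \<le> a) \<and> odd (cval A)" for A
    using X0_le[OF _ _ generated_by_4] odd_pos that by simp
  have X2: "X0 {#k#} \<le> 2 * cval {#k#} + 1" if "2 \<le> k" "even k" for k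
    using X0_le[OF _ _ generated_by_2[OF that]] that by (simp add: cval_def)
  show "\<exists>X. 0 < X \<and> (\<forall>n\<ge>X. f_gen A n = enat (nat \<lceil>(real n - 1) / real (cval A)\<rceil>))"
    if "(\<forall>a\<in>#A. 2 \<le> a) \<and> odd (cval A)" for A
  proof (intro exI conjI allI impI)
    show "0 < 4 * cval A + 1" by simp
    show "f_gen A n = enat (nat \<lceil>(real n - 1) / real (cval A)\<rceil>)" if "4 * cval A + 1 \<le> n" for n
      using f_gen_eq[OF _ _ generated_by_4 _ that] \<open>_ \<and> odd (cval A)\<close> odd_pos by simp
  qed
  show "X0 {#k#} \<le> 2 * k - 1" if "2 \<le> k \<and> even k" for k
    using X2[of k] that by (auto simp: cval_def)
  show "X0 (replicate_mset k 2) \<le> ((2 * k + 1) choose 2) + 1" if k: "1 \<le> k \<and> odd k" for k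
  proof -
    have c: "cval (replicate_mset k 2) = k" by (simp add: cval_def)
    have choose: "(2 * k + 1) choose 2 = k * (2 * k + 1)" by (simp add: choose_two)
    show ?thesis
    \<comment> \<open>For \<open>k = 1\<close> the claimed bound is 4, less than
      \<open>4 * k + 1\<close>, so the base with two generators is needed.\<close>
    proof (cases "k = 1")
      case True
      have "X0 {#2#} \<le> 3" using X2[of 2] by (simp add: cval_def)
      then show ?thesis using True by (simp add: choose_two numeral_eq_Suc)
    next
      case False
      then have "2 \<le> k" using k by simp
      then have "k * 4 \<le> k * (2 * k + 1)" by (intro mult_le_mono2) simp
      then have "4 * k + 1 \<le> ((2 * k + 1) choose 2) + 1" unfolding choose by linarith
      moreover have "X0 (replicate_mset k 2) \<le> 4 * k + 1"
        using X4[of "replicate_mset k 2"] k c by simp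
      ultimately show ?thesis by (rule order_trans[rotated])
    qed
  qed
  show "(of_nat (X0 A) :: complex) \<le>
      of_nat (cval A) * poly (cyclotomic (2 * size A)) (of_nat (2 * size A)) + 1"
    if A: "(\<forall>a\<in>#A. 2 \<le> a) \<and> odd (cval A)" for A
  proof -
    \<comment> \<open>Here \<open>T\<close> is the number of generators in the base: 4 against a
      value of at least \<open>(2 * size A - 1)\<^sup>2\<close>, or 2 against the value 3 when
      \<open>A\<close> is a single cycle.\<close>
    obtain y :: real and T where y: "poly (cyclotomic (2 * size A)) (of_nat (2 * size A)) = of_real y"
      "real T \<le> y" and T: "X0 A \<le> T * cval A + 1"
    proof (cases "2 \<le> size A")
      case True
      then obtain y where y: "poly (cyclotomic (2 * size A)) (of_real (real (2 * size A))) = of_real y"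
        "(real (2 * size A) - 1)\<^sup>2 \<le> y"
        using cyclotomic_lower_bound[of "2 * size A" "real (2 * size A)"] by auto
      have "(2::real)\<^sup>2 \<le> (real (2 * size A) - 1)\<^sup>2" using True by (intro power_mono) auto
      then show thesis using that[of y 4] y X4[OF A] by simp
    next
      case False
      have "A \<noteq> {#}" using A by (auto simp: cval_def)
      then have "size A = 1" using False by (cases "size A") auto
      then obtain k where k: "A = {#k#}" using size_1_singleton_mset by blast
      have "2 \<le> k" "even k" using A k by (auto simp: cval_def)
      then show thesis using that[of 3 2] X2[of k] k by (simp add: poly_cyclotomic_2)
    qed
    have "real (X0 A) \<le> real T * real (cval A) + 1"
      using T by (metis of_nat_1 of_nat_add of_nat_le_iff of_nat_mult)
    also have "\<dots> \<le> real (cval A) * y + 1"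
      using mult_right_mono[OF y(2), of "real (cval A)"] by (simp add: mult.commute)
    finally show ?thesis unfolding y(1) by (simp add: less_eq_complex_def)
  qed
qed

end
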